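(* Let $D\in\mathbb{R}^{n\times n}$ be positive definite (not necessarily symmetric), $Q\in\mathbb{R}^{n\times n}$ symmetric, $E:\mathbb{R}^n\to\mathbb{R}$ an $L_E$-smooth function, and $V(x)=\frac12\langle x,Qx\rangle+E(x)$. If $x_k\in\mathbb{R}^n$ satisfies $\langle\nabla E(x_k),D\nabla V(x_k)\rangle\neq 0$, then for all sufficiently small $h>0$ there exists a solution $(x_{k+1},\eta_k)\in\mathbb{R}^n\times\mathbb{R}$ of the system $$\frac{x_{k+1}-x_k}{h}=-D\left(Q\left(\frac{x_{k+1}+x_k}{2}\right)+\eta_k\nabla E(x_k)\right),$$ $$E(x_{k+1})-E(x_k)=\eta_k\langle\nabla E(x_k),x_{k+1}-x_k\rangle.$$
   Context: A matrix $D$ is positive definite if $\langle x,Dx\rangle>0$ for all $x\neq0$ (symmetry is not required). A function $E$ is $L_E$-smooth if it is differentiable and $\nabla E$ is Lipschitz continuous with constant $L_E$. The displayed system is one step (with step size $h$, from the given point $x_k$) of the Lagrange multiplier scheme for the gradient flow $\dot x=-D\nabla V(x)$. *)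

theory Defs
  imports "HOL-Analysis.Analysis"
begin

definition positive_definite_matrix :: "real ^ 'n ^ 'n \<Rightarrow> bool" where
  "positive_definite_matrix D \<longleftrightarrow> (\<forall>x. x \<noteq> 0 \<longrightarrow> x \<bullet> (D *v x) > 0)"

(* Only meaningful at points of differentiability, where GDERIV determines the vector uniquely. *)
definition gradient :: "('a::real_inner \<Rightarrow> real) \<Rightarrow> 'a \<Rightarrow> 'a" where
  "gradient f x = (THE g. GDERIV f x :> g)"

definition L_smooth :: "real \<Rightarrow> ('a::real_inner \<Rightarrow> real) \<Rightarrow> bool" where
  "L_smooth L f \<longleftrightarrow> (\<forall>x. f differentiable (at x)) \<and> L-lipschitz_on UNIV (gradient f)"

end

theory Submission
  imports Defs
begin

text \<open>
  Write \<open>x\<close> for \<open>x\<^sub>k\<close>, \<open>g\<close> for \<open>\<nabla>E(x)\<close> and \<open>x' = x + h u\<close>.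
  For fixed \<open>\<eta>\<close> and small \<open>h\<close> the first equation is the uniquely solvable linear system
  \<open>(I + h/2 DQ) u = -D(Q x + \<eta> g)\<close>, and \<open>u\<close> tends to \<open>v(\<eta>) = -D(Q x + \<eta> g)\<close> as \<open>h\<close> tends
  to \<open>0\<close>. Divided by \<open>h\<close>, the residual of the second equation is continuous in \<open>\<eta>\<close> and
  tends to \<open>(1 - \<eta>) \<langle>g, v(\<eta>)\<rangle>\<close>. Since \<open>v(1) = -D\<nabla>V(x)\<close>, the hypothesis says that this
  limit changes sign at \<open>\<eta> = 1\<close>, and the intermediate value theorem gives a root near \<open>1\<close>.
\<close>

lemma gradient_eqI:
  assumes "GDERIV f x :> g"
  shows "gradient f x = g"
  unfolding gradient_def
proof (rule the_equality)
  show "GDERIV f x :> g" by (rule assms)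
next
  fix g' assume "GDERIV f x :> g'"
  then have "(\<lambda>y. y \<bullet> g') = (\<lambda>y. y \<bullet> g)"
    using assms unfolding gderiv_def by (rule has_derivative_unique)
  then have "(g' - g) \<bullet> g' = (g' - g) \<bullet> g" by (rule fun_cong)
  then have "(g' - g) \<bullet> (g' - g) = 0" by (simp add: inner_diff_right)
  then show "g' = g" by simp
qed

text \<open>Riesz representation: the derivative \<open>f'\<close> is a linear functional, hence the
  inner product with the vector \<open>adjoint f' 1\<close>.\<close>

lemma GDERIV_gradient:
  fixes f :: "'a::euclidean_space \<Rightarrow> real"
  assumes "f differentiable (at x)"
  shows "GDERIV f x :> gradient f x"
proof -
  obtain f' where f': "(f has_derivative f') (at x)"
    using assms by (auto simp: differentiable_def)
  then have "linear f'" by (rule has_derivative_linear)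
  then have "f' = (\<lambda>y. y \<bullet> adjoint f' 1)"
    using adjoint_works[of f' _ 1] by fastforce
  then have "GDERIV f x :> adjoint f' 1"
    using f' unfolding gderiv_def by simp
  then show ?thesis using gradient_eqI by metis
qed

text \<open>The product rule gives two terms, which coincide by symmetry of \<open>Q\<close> and
  absorb the factor 1/2.\<close>

lemma GDERIV_quadratic_form:
  fixes Q :: "real ^ 'n ^ 'n"
  assumes "transpose Q = Q"
  shows "GDERIV (\<lambda>x. 1/2 * (x \<bullet> (Q *v x))) x :> Q *v x"
proof -
  have sym: "x \<bullet> (Q *v y) = y \<bullet> (Q *v x)" for y
    by (metis assms dot_lmul_matrix inner_commute transpose_matrix_vector)
  have "((*v) Q has_derivative (*v) Q) (at x)"
    by (rule bounded_linear_imp_has_derivative) (rule matrix_vector_mul_bounded_linear)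
  then have "((\<lambda>x. 1/2 * (x \<bullet> (Q *v x))) has_derivative
      (\<lambda>y. 1/2 * (x \<bullet> (Q *v y) + y \<bullet> (Q *v x)))) (at x)"
    by (intro has_derivative_mult_right has_derivative_inner has_derivative_ident)
  then show ?thesis
    unfolding gderiv_def sym by simp
qed

text \<open>The direction \<open>u h\<close> may vary with \<open>h\<close>: the curve
  \<open>x + h *\<^sub>R u h\<close> still has right derivative \<open>v\<close> at 0, so the chain
  rule applies. The value \<open>u 0\<close> is irrelevant, since it is multiplied by 0.\<close>

lemma GDERIV_directional_limit:
  assumes g: "GDERIV f x :> g" and u: "(u \<longlongrightarrow> v) (at_right 0)"
  shows "((\<lambda>h. (f (x + h *\<^sub>R u h) - f x) / h) \<longlongrightarrow> g \<bullet> v) (at_right 0)"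
proof -
  define y where "y h = x + h *\<^sub>R u h" for h
  have "(y has_vector_derivative v) (at_right 0)"
    unfolding has_vector_derivative_def has_derivative_within
  proof (intro conjI bounded_linear_scaleR_left)
    have "((\<lambda>h. u h - v) \<longlongrightarrow> 0) (at_right 0)"
      using u by (rule LIM_zero)
    then show "((\<lambda>h. (1 / norm (h - 0)) *\<^sub>R (y h - (y 0 + (h - 0) *\<^sub>R v))) \<longlongrightarrow> 0) (at_right 0)"
    proof (rule Lim_transform_eventually)
      show "\<forall>\<^sub>F h in at_right 0. u h - v = (1 / norm (h - 0)) *\<^sub>R (y h - (y 0 + (h - 0) *\<^sub>R v))"
        using eventually_at_right_less[of "0::real"]
      proof eventually_elim
        case (elim h)
        then show ?case by (simp add: y_def flip: scaleR_diff_right)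
      qed
    qed
  qed
  moreover have "(f has_derivative (\<lambda>z. z \<bullet> g)) (at (y 0))"
    using g by (simp add: gderiv_def y_def)
  ultimately have "((\<lambda>h. f (y h)) has_derivative (\<lambda>h. (h *\<^sub>R v) \<bullet> g)) (at_right 0)"
    unfolding has_vector_derivative_def by (rule has_derivative_compose)
  then have "((\<lambda>h. f (y h)) has_field_derivative (g \<bullet> v)) (at_right 0)"
    by (simp add: has_field_derivative_def inner_commute mult_commute_abs)
  then show ?thesis
    by (simp add: has_field_derivative_iff y_def)
qed

text \<open>\<open>N h\<close> is the inverse of \<open>I + h T\<close>. If \<open>K\<close> bounds
  \<open>T\<close> and \<open>h * K < 1/2\<close>, then \<open>I + h T\<close> shrinks norms at most
  by a factor of 2, so it is injective and, in finite dimension, bijective. The same bound gives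
  \<open>norm (N h w) \<le> 2 * norm w\<close>, whence \<open>N h w - w = - h T (N h w)\<close> is
  of order \<open>h\<close>.\<close>

lemma resolvent_at_zero:
  fixes T :: "'a::euclidean_space \<Rightarrow> 'a"
  assumes T: "linear T"
  obtains N :: "real \<Rightarrow> 'a \<Rightarrow> 'a"
  where "\<forall>\<^sub>F h in at_right 0. linear (N h) \<and> (\<forall>w. N h w + h *\<^sub>R T (N h w) = w)"
    and "\<And>w. ((\<lambda>h. N h w) \<longlongrightarrow> w) (at_right 0)"
proof -
  obtain K where K: "K > 0" "\<And>x. norm (T x) \<le> norm x * K"
    using bounded_linear.pos_bounded linear_conv_bounded_linear T by metis
  define f where "f h x = x + h *\<^sub>R T x" for h :: real and x
  define N where "N h = inv (f h)" for h
  have lin: "linear (f h)" for h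
    unfolding f_def by (intro linear_compose_add linear_compose_scale_right T linear_ident)
  have small: "\<forall>\<^sub>F h in at_right 0. 0 < h \<and> h * K < 1/2"
  proof -
    have "((\<lambda>h. h * K) \<longlongrightarrow> 0 * K) (at_right 0)" by (intro tendsto_intros)
    then have "\<forall>\<^sub>F h in at_right 0. h * K < 1/2" by (rule order_tendstoD) simp
    then show ?thesis using eventually_at_right_less[of 0] by eventually_elim simp
  qed
  have pert: "norm (f h x - x) \<le> h * K * norm x" if "0 < h" for h x
    using K(2)[of x] that by (simp add: f_def mult.commute mult.left_commute)
  have lower: "norm x \<le> 2 * norm (f h x)" if "0 < h" "h * K < 1/2" for h x
  proof -
    have "h * K * norm x \<le> 1/2 * norm x" using that by (intro mult_right_mono) auto
    then have "norm (f h x - x) \<le> 1/2 * norm x" using pert[OF that(1), of x] by linarith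
    then show ?thesis using norm_triangle_sub[of x "f h x"] by (simp add: norm_minus_commute)
  qed
  have bij: "bij (f h)" if "0 < h" "h * K < 1/2" for h
  proof -
    have "inj (f h)"
      unfolding linear_injective_0[OF lin]
    proof (intro allI impI)
      fix x assume "f h x = 0"
      then show "x = 0" using lower[OF that, of x] by simp
    qed
    then show ?thesis
      using linear_injective_imp_surjective[OF lin] by (simp add: bij_def)
  qed
  have fN: "f h (N h w) = w" if "0 < h" "h * K < 1/2" for h w
    using bij[OF that] unfolding N_def by (simp add: bij_is_surj surj_f_inv_f)
  have "linear (N h)" if "0 < h" "h * K < 1/2" for h
    unfolding N_def using inj_linear_imp_inv_linear[OF lin] bij[OF that] by (simp add: bij_is_inj)
  then have "\<forall>\<^sub>F h in at_right 0. linear (N h) \<and> (\<forall>w. N h w + h *\<^sub>R T (N h w) = w)"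
    using small fN by (auto simp: f_def elim!: eventually_mono)
  moreover have "((\<lambda>h. N h w) \<longlongrightarrow> w) (at_right 0)" for w
  proof (rule LIM_zero_cancel, rule tendsto_0_le[where K = 1])
    show "((\<lambda>h. h * K * (2 * norm w)) \<longlongrightarrow> 0) (at_right 0)"
      by (auto intro!: tendsto_eq_intros)
    show "\<forall>\<^sub>F h in at_right 0. norm (N h w - w) \<le> norm (h * K * (2 * norm w)) * 1"
      using small
    proof eventually_elim
      case (elim h)
      have "norm (N h w - w) \<le> h * K * norm (N h w)"
        using pert[of h "N h w"] fN[of h w] elim by (simp add: norm_minus_commute)
      also have "\<dots> \<le> h * K * (2 * norm w)"
        using lower[of h "N h w"] fN[of h w] elim K(1) by (intro mult_left_mono) auto
      finally show ?case by simp
    qed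
  qed
  ultimately show thesis by (rule that)
qed

theorem theorem3p3:
  fixes D Q :: "real ^ 'n ^ 'n"
    and E V :: "real ^ 'n \<Rightarrow> real"
    and L\<^sub>E :: real
    and x\<^sub>k :: "real ^ 'n"
  assumes "positive_definite_matrix D"
    and "transpose Q = Q"
    and "L_smooth L\<^sub>E E"
    and V: "\<And>x. V x = 1/2 * (x \<bullet> (Q *v x)) + E x"
    and "gradient E x\<^sub>k \<bullet> (D *v gradient V x\<^sub>k) \<noteq> 0"
  shows "\<exists>h\<^sub>0>0. \<forall>h. 0 < h \<and> h < h\<^sub>0 \<longrightarrow>
    (\<exists>(x' :: real ^ 'n) (\<eta> :: real).
       (1 / h) *\<^sub>R (x' - x\<^sub>k) =
         - (D *v (Q *v ((1/2) *\<^sub>R (x' + x\<^sub>k)) + \<eta> *\<^sub>R gradient E x\<^sub>k)) \<and>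
       E x' - E x\<^sub>k = \<eta> * (gradient E x\<^sub>k \<bullet> (x' - x\<^sub>k)))"
proof -
  define g where "g = gradient E x\<^sub>k"
  have diffE: "E differentiable (at x)" for x
    using assms(3) by (auto simp: L_smooth_def)
  have gE: "GDERIV E x\<^sub>k :> g"
    unfolding g_def by (rule GDERIV_gradient[OF diffE])
  have contE: "continuous_on UNIV E"
    using diffE by (simp add: continuous_on_eq_continuous_at differentiable_imp_continuous_within)
  have "GDERIV V x\<^sub>k :> Q *v x\<^sub>k + g"
    using GDERIV_add[OF GDERIV_quadratic_form[OF assms(2), of x\<^sub>k] gE] by (simp add: V[abs_def])
  then have gradV: "gradient V x\<^sub>k = Q *v x\<^sub>k + g" by (rule gradient_eqI)
  \<comment> \<open>The factor 1/2 stems from the midpoint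
    \<open>x\<^sub>k + (h/2) *\<^sub>R u\<close> in the scheme.\<close>
  have "linear (\<lambda>y. (1/2) *\<^sub>R (D *v (Q *v y)))"
    by (rule linearI) (simp_all add: matrix_vector_right_distrib matrix_vector_mult_scaleR scaleR_add_right)
  then obtain N where N: "\<forall>\<^sub>F h in at_right 0. linear (N h) \<and>
        (\<forall>w. N h w + h *\<^sub>R (1/2) *\<^sub>R (D *v (Q *v N h w)) = w)"
      and Nlim: "\<And>w. ((\<lambda>h. N h w) \<longlongrightarrow> w) (at_right 0)"
    by (rule resolvent_at_zero) blast
  define v where "v \<eta> = - (D *v (Q *v x\<^sub>k + \<eta> *\<^sub>R g))" for \<eta>
  define c where "c = g \<bullet> v 1"
  define q where "q = g \<bullet> (D *v g)"
  have c: "c \<noteq> 0" using assms(5) by (simp add: c_def v_def gradV g_def[symmetric])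
  have v_affine: "v \<eta> = - (D *v (Q *v x\<^sub>k)) - \<eta> *\<^sub>R (D *v g)" for \<eta>
    by (simp add: v_def matrix_vector_right_distrib matrix_vector_mult_scaleR)
  \<comment> \<open>Affine in \<eta>, so its sign near \<eta> = 1 is that of \<open>c\<close>, the
    negative of the quantity assumed nonzero.\<close>
  have gv: "g \<bullet> v \<eta> = c - (\<eta> - 1) * q" for \<eta>
    by (simp add: c_def q_def v_affine inner_diff_right algebra_simps)
  \<comment> \<open>The residual of the second equation divided by \<open>h\<close>. The extra
    factor \<open>c\<close> makes the sign change go from positive to negative whatever the sign of
    \<open>c\<close>.\<close>
  define F where "F h \<eta> = c * ((E (x\<^sub>k + h *\<^sub>R N h (v \<eta>)) - E x\<^sub>k) / h - \<eta> * (g \<bullet> N h (v \<eta>)))" for h \<eta>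
  have Flim: "((\<lambda>h. F h \<eta>) \<longlongrightarrow> c * (g \<bullet> v \<eta> - \<eta> * (g \<bullet> v \<eta>))) (at_right 0)" for \<eta>
    unfolding F_def by (intro tendsto_intros GDERIV_directional_limit[OF gE] Nlim)
  \<comment> \<open>The limits of \<open>F\<close> at 1 - \<delta> and 1 + \<delta> are
    \<open>\<delta> * (c\<^sup>2 + \<delta> * (c * q))\<close> and
    \<open>- (\<delta> * (c\<^sup>2 - \<delta> * (c * q)))\<close>. This choice keeps the
    perturbation \<open>\<delta> * \<bar>c * q\<bar>\<close> at most half of
    \<open>c\<^sup>2\<close>; the summand 1 prevents division by zero when
    \<open>q = 0\<close>.\<close>
  define \<delta> where "\<delta> = c\<^sup>2 / (2 * (\<bar>c * q\<bar> + 1))"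
  have \<delta>: "\<delta> > 0" using c by (auto simp: \<delta>_def intro!: divide_pos_pos)
  have "\<delta> * \<bar>c * q\<bar> \<le> \<delta> * (\<bar>c * q\<bar> + 1)" using \<delta> by simp
  also have "\<dots> = c\<^sup>2 / 2" by (simp add: \<delta>_def field_simps)
  also have "\<dots> < c\<^sup>2" using c by simp
  finally have "\<bar>\<delta> * (c * q)\<bar> < c\<^sup>2" using \<delta> by (simp add: abs_mult)
  then have pos: "c\<^sup>2 + \<delta> * (c * q) > 0" "c\<^sup>2 - \<delta> * (c * q) > 0" by linarith+
  have "c * (g \<bullet> v (1 - \<delta>) - (1 - \<delta>) * (g \<bullet> v (1 - \<delta>))) = \<delta> * (c\<^sup>2 + \<delta> * (c * q))"
    unfolding gv by (simp add: algebra_simps power2_eq_square)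
  then have "\<forall>\<^sub>F h in at_right 0. F h (1 - \<delta>) > 0"
    using \<delta> pos(1) by (intro order_tendstoD(1)[OF Flim]) simp
  moreover have "c * (g \<bullet> v (1 + \<delta>) - (1 + \<delta>) * (g \<bullet> v (1 + \<delta>))) = - (\<delta> * (c\<^sup>2 - \<delta> * (c * q)))"
    unfolding gv by (simp add: algebra_simps power2_eq_square)
  then have "\<forall>\<^sub>F h in at_right 0. F h (1 + \<delta>) < 0"
    using \<delta> pos(2) by (intro order_tendstoD(2)[OF Flim]) simp
  \<comment> \<open>As \<delta> does not depend on \<open>h\<close>, both sign conditions and the
    solvability of the linear system hold together for all small \<open>h\<close>.\<close>
  ultimately have "\<forall>\<^sub>F h in at_right 0. \<exists>x' \<eta>.
       (1 / h) *\<^sub>R (x' - x\<^sub>k) = - (D *v (Q *v ((1/2) *\<^sub>R (x' + x\<^sub>k)) + \<eta> *\<^sub>R g)) \<and>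
       E x' - E x\<^sub>k = \<eta> * (g \<bullet> (x' - x\<^sub>k))"
    using N eventually_at_right_less[of 0]
  proof eventually_elim
    case (elim h)
    then have h: "h > 0" and lin: "linear (N h)"
      and eq: "N h w + h *\<^sub>R (1/2) *\<^sub>R (D *v (Q *v N h w)) = w" for w by auto
    have "continuous_on {1 - \<delta>..1 + \<delta>} (\<lambda>\<eta>. N h (v \<eta>))"
      by (rule linear_continuous_on_compose[OF _ lin]) (auto simp: v_affine intro!: continuous_intros)
    then have "continuous_on {1 - \<delta>..1 + \<delta>} (F h)"
      unfolding F_def using h
      by (intro continuous_intros continuous_on_compose2[OF contE]) auto
    then obtain \<eta> where "F h \<eta> = 0"
      using IVT2'[of "F h" "1 + \<delta>" 0 "1 - \<delta>"] elim \<delta> by auto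
    define u where "u = N h (v \<eta>)"
    have "(E (x\<^sub>k + h *\<^sub>R u) - E x\<^sub>k) / h = \<eta> * (g \<bullet> u)"
      using \<open>F h \<eta> = 0\<close> c by (simp add: F_def u_def)
    then have "E (x\<^sub>k + h *\<^sub>R u) - E x\<^sub>k = \<eta> * (g \<bullet> (h *\<^sub>R u))"
      using h by (simp add: field_simps)
    \<comment> \<open>With the midpoint in this form, the first equation of the scheme becomes the
      resolvent identity \<open>eq\<close> at \<open>v \<eta>\<close>.\<close>
    moreover have "(1/2) *\<^sub>R (x\<^sub>k + h *\<^sub>R u + x\<^sub>k) = x\<^sub>k + (h/2) *\<^sub>R u"
      by (simp add: vec_eq_iff field_simps)
    then have "- (D *v (Q *v ((1/2) *\<^sub>R (x\<^sub>k + h *\<^sub>R u + x\<^sub>k)) + \<eta> *\<^sub>R g)) =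
        v \<eta> - h *\<^sub>R (1/2) *\<^sub>R (D *v (Q *v u))"
      by (simp add: v_affine matrix_vector_right_distrib matrix_vector_mult_scaleR)
    then have "(1 / h) *\<^sub>R (h *\<^sub>R u) =
        - (D *v (Q *v ((1/2) *\<^sub>R (x\<^sub>k + h *\<^sub>R u + x\<^sub>k)) + \<eta> *\<^sub>R g))"
      using eq[of "v \<eta>"] h by (simp add: u_def[symmetric] algebra_simps)
    ultimately show ?case
      by (intro exI[of _ "x\<^sub>k + h *\<^sub>R u"] exI[of _ \<eta>]) simp
  qed
  then show ?thesis
    unfolding g_def eventually_at_right_field by auto
qed

end
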